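(* Let $\Omega\subseteq\mathbb{R}^m$ be an open set containing $0$. Then $\mathcal{F}(\Omega)=\mathrm{Lip}_0(\Omega)[\mathcal{P}_{\mathrm{Lip}}]^*$ (as normed spaces of linear forms on $\mathrm{Lip}_0(\Omega)$).
   Context: $m\geq2$. $\mathrm{Lip}_0(\Omega)$ is the Banach space of Lipschitz functions $u:\Omega\to\mathbb{R}$ with $u(0)=0$, normed by $\|u\|_L=\mathrm{Lip}\,u$. $\mathcal{F}(\Omega)$ (Lipschitz-free space) is the closure in the Banach dual $\mathrm{Lip}_0(\Omega)^*$ of the span of the evaluations $u\mapsto u(x)$, $x\in\Omega$, with the norm of $\mathrm{Lip}_0(\Omega)^*$. $\mathcal{P}_{\mathrm{Lip}}$ is the localized locally convex topology on $\mathrm{Lip}_0(\Omega)$ associated with the topology of pointwise convergence and the sets $\{u:\|u\|_L\leq k\}$, $k\in\mathbb{N}$. Its dual $\mathrm{Lip}_0(\Omega)[\mathcal{P}_{\mathrm{Lip}}]^*$ is exactly the space of linear forms $F:\mathrm{Lip}_0(\Omega)\to\mathbb{R}$ such that for every $\varepsilon>0$ there are a finite non-empty set $E\subset\Omega$ and $\theta>0$ with $|\langle u,F\rangle|\leq\theta\max_{x\in E}|u(x)|+\varepsilon\|u\|_L$ for all $u\in\mathrm{Lip}_0(\Omega)$; this can be taken as the definition. The strong topology of this dual is given by the norm $|||F|||=\sup\{|\langle u,F\rangle|:\|u\|_L\leq1\}$. *)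

theory Defs
  imports "HOL-Analysis.Analysis" "HOL-Library.Function_Algebras"
begin

text \<open>
  A function on \<open>\<Omega>\<close> is represented by its extension by \<open>0\<close> to the ambient space, and a linear form
  on \<open>Lip\<^sub>0(\<Omega>)\<close> by its extension by \<open>0\<close> to all functions. Hence equality in \<open>HOL\<close> is equality on
  \<open>\<Omega>\<close> and on \<open>Lip\<^sub>0(\<Omega>)\<close>, respectively, and all vector space operations are pointwise.
\<close>

definition lip0 :: "'a::real_normed_vector set \<Rightarrow> ('a \<Rightarrow> real) set" where
  "lip0 \<Omega> = {u. (\<exists>L. L-lipschitz_on \<Omega> u) \<and> u 0 = 0 \<and> (\<forall>x. x \<notin> \<Omega> \<longrightarrow> u x = 0)}"

definition lip_norm :: "'a::real_normed_vector set \<Rightarrow> ('a \<Rightarrow> real) \<Rightarrow> real" where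
  "lip_norm \<Omega> u = Inf {L. L-lipschitz_on \<Omega> u}"

definition lip0_forms :: "'a::real_normed_vector set \<Rightarrow> (('a \<Rightarrow> real) \<Rightarrow> real) set" where
  "lip0_forms \<Omega> = {F.
     (\<forall>u\<in>lip0 \<Omega>. \<forall>v\<in>lip0 \<Omega>. F (\<lambda>x. u x + v x) = F u + F v) \<and>
     (\<forall>u\<in>lip0 \<Omega>. \<forall>c. F (\<lambda>x. c * u x) = c * F u) \<and>
     (\<forall>u. u \<notin> lip0 \<Omega> \<longrightarrow> F u = 0)}"

definition lip0_dual :: "'a::real_normed_vector set \<Rightarrow> (('a \<Rightarrow> real) \<Rightarrow> real) set" where
  "lip0_dual \<Omega> = {F \<in> lip0_forms \<Omega>. \<exists>C. \<forall>u\<in>lip0 \<Omega>. \<bar>F u\<bar> \<le> C * lip_norm \<Omega> u}"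

text \<open>The operator norm, as in \<^const>\<open>onorm\<close>; the quotient is \<open>0\<close> for \<open>u = 0\<close>.\<close>

definition dual_norm :: "'a::real_normed_vector set \<Rightarrow> (('a \<Rightarrow> real) \<Rightarrow> real) \<Rightarrow> real" where
  "dual_norm \<Omega> F = (SUP u\<in>lip0 \<Omega>. \<bar>F u\<bar> / lip_norm \<Omega> u)"

definition lip0_eval :: "'a::real_normed_vector set \<Rightarrow> 'a \<Rightarrow> ('a \<Rightarrow> real) \<Rightarrow> real" where
  "lip0_eval \<Omega> x = (\<lambda>u. if u \<in> lip0 \<Omega> then u x else 0)"

text \<open>\<^const>\<open>Metric_space\<close> asks for nonnegativity also off the carrier, where the supremum in
  \<open>dual_norm\<close> may be an unspecified real number; hence the case distinction.\<close>

definition dual_dist ::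
  "'a::real_normed_vector set \<Rightarrow> (('a \<Rightarrow> real) \<Rightarrow> real) \<Rightarrow> (('a \<Rightarrow> real) \<Rightarrow> real) \<Rightarrow> real" where
  "dual_dist \<Omega> F G =
     (if F \<in> lip0_dual \<Omega> \<and> G \<in> lip0_dual \<Omega> then dual_norm \<Omega> (\<lambda>u. F u - G u) else 0)"

definition dual_topology :: "'a::real_normed_vector set \<Rightarrow> (('a \<Rightarrow> real) \<Rightarrow> real) topology" where
  "dual_topology \<Omega> = Metric_space.mtopology (lip0_dual \<Omega>) (dual_dist \<Omega>)"

text \<open>The dual of \<open>Lip\<^sub>0(\<Omega>)\<close> is a subspace of the space of all real functions on \<open>'a \<Rightarrow> real\<close>,
  so the span may be formed in the latter.\<close>

definition lip_free :: "'a::real_normed_vector set \<Rightarrow> (('a \<Rightarrow> real) \<Rightarrow> real) set" where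
  "lip_free \<Omega> = dual_topology \<Omega> closure_of
     module.span (\<lambda>(c::real) F u. c * F u) (lip0_eval \<Omega> ` \<Omega>)"

text \<open>The dual of \<open>Lip\<^sub>0(\<Omega>)\<close> under the localized topology \<open>P\<^sub>L\<^sub>i\<^sub>p\<close>, given by the description of its
  continuous linear forms, and the norm of its strong topology.\<close>

definition plip_dual :: "'a::real_normed_vector set \<Rightarrow> (('a \<Rightarrow> real) \<Rightarrow> real) set" where
  "plip_dual \<Omega> = {F \<in> lip0_forms \<Omega>. \<forall>\<epsilon>>0. \<exists>E \<theta>. finite E \<and> E \<noteq> {} \<and> E \<subseteq> \<Omega> \<and> \<theta> > 0 \<and>
     (\<forall>u\<in>lip0 \<Omega>. \<bar>F u\<bar> \<le> \<theta> * Max ((\<lambda>x. \<bar>u x\<bar>) ` E) + \<epsilon> * lip_norm \<Omega> u)}"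

definition strong_norm :: "'a::real_normed_vector set \<Rightarrow> (('a \<Rightarrow> real) \<Rightarrow> real) \<Rightarrow> real" where
  "strong_norm \<Omega> F = Sup {\<bar>F u\<bar> |u. u \<in> lip0 \<Omega> \<and> lip_norm \<Omega> u \<le> 1}"


text \<open>The library notions used above, \<^const>\<open>Metric_space.mtopology\<close> and \<^const>\<open>module.span\<close>, are
  specified only under the assumptions of their locales, which are established here.\<close>

lemma vector_space_pointwise:
  "vector_space (\<lambda>(c::real) (F :: 'b \<Rightarrow> real) u. c * F u)"
  by unfold_locales (auto simp: fun_eq_iff algebra_simps)

lemma lip_norm_lipschitz:
  assumes "u \<in> lip0 \<Omega>"
  shows "(lip_norm \<Omega> u)-lipschitz_on \<Omega> u"
proof -
  let ?S = "{L. L-lipschitz_on \<Omega> u}"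
  have ne: "?S \<noteq> {}" using assms by (auto simp: lip0_def)
  show ?thesis
  proof (rule lipschitz_onI)
    show "0 \<le> lip_norm \<Omega> u"
      unfolding lip_norm_def using ne
      by (intro cInf_greatest) (auto dest: lipschitz_on_nonneg)
  next
    fix x y assume xy: "x \<in> \<Omega>" "y \<in> \<Omega>"
    show "dist (u x) (u y) \<le> lip_norm \<Omega> u * dist x y"
    proof (cases "x = y")
      case False
      have "dist (u x) (u y) / dist x y \<le> lip_norm \<Omega> u"
        unfolding lip_norm_def using ne False xy
        by (intro cInf_greatest) (auto simp: divide_le_eq dest: lipschitz_onD)
      then show ?thesis using False by (simp add: divide_le_eq)
    qed simp
  qed
qed

lemma lip_norm_nonneg: "u \<in> lip0 \<Omega> \<Longrightarrow> 0 \<le> lip_norm \<Omega> u"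
  using lip_norm_lipschitz lipschitz_on_nonneg by blast

lemma lip_norm_eq_0:
  assumes "u \<in> lip0 \<Omega>" "lip_norm \<Omega> u = 0" "0 \<in> \<Omega>"
  shows "u = (\<lambda>x. 0)"
proof
  fix x
  show "u x = 0"
  proof (cases "x \<in> \<Omega>")
    case True
    have "dist (u x) (u 0) \<le> 0"
      using lipschitz_onD[OF lip_norm_lipschitz[OF assms(1)] True assms(3)] assms(2) by simp
    then show ?thesis using assms(1) by (simp add: lip0_def)
  qed (use assms(1) in \<open>simp add: lip0_def\<close>)
qed

lemma zero_in_lip0: "(\<lambda>x. 0) \<in> lip0 \<Omega>"
  by (auto simp: lip0_def intro!: exI[of _ 0] lipschitz_on_constant)

lemma lip0_form_zero:
  assumes "F \<in> lip0_forms \<Omega>"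
  shows "F (\<lambda>x. 0) = 0"
proof -
  have "\<forall>u\<in>lip0 \<Omega>. \<forall>c. F (\<lambda>x. c * u x) = c * F u"
    using assms by (simp add: lip0_forms_def)
  from bspec[OF this zero_in_lip0, THEN spec[of _ 0]] show ?thesis by simp
qed

lemma lip0_dual_diff:
  assumes "F \<in> lip0_dual \<Omega>" "G \<in> lip0_dual \<Omega>"
  shows "(\<lambda>u. F u - G u) \<in> lip0_dual \<Omega>"
proof -
  obtain C D where C: "\<forall>u\<in>lip0 \<Omega>. \<bar>F u\<bar> \<le> C * lip_norm \<Omega> u"
    and D: "\<forall>u\<in>lip0 \<Omega>. \<bar>G u\<bar> \<le> D * lip_norm \<Omega> u"
    using assms by (auto simp: lip0_dual_def)
  have "\<forall>u\<in>lip0 \<Omega>. \<bar>F u - G u\<bar> \<le> (C + D) * lip_norm \<Omega> u"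
    using C D by (fastforce simp: distrib_right)
  moreover have "(\<lambda>u. F u - G u) \<in> lip0_forms \<Omega>"
    using assms by (auto simp: lip0_dual_def lip0_forms_def algebra_simps)
  ultimately show ?thesis by (auto simp: lip0_dual_def)
qed

lemma dual_norm_bound:
  assumes "F \<in> lip0_dual \<Omega>" "u \<in> lip0 \<Omega>"
  shows "\<bar>F u\<bar> / lip_norm \<Omega> u \<le> dual_norm \<Omega> F"
proof -
  obtain C where C: "\<forall>u\<in>lip0 \<Omega>. \<bar>F u\<bar> \<le> C * lip_norm \<Omega> u"
    using assms(1) by (auto simp: lip0_dual_def)
  have "\<bar>F v\<bar> / lip_norm \<Omega> v \<le> max C 0" if v: "v \<in> lip0 \<Omega>" for v
  proof (cases "lip_norm \<Omega> v = 0")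
    case False
    then have "lip_norm \<Omega> v > 0" using lip_norm_nonneg[OF v] by simp
    then have "\<bar>F v\<bar> / lip_norm \<Omega> v \<le> C" using C v by (simp add: divide_le_eq)
    then show ?thesis by simp
  qed simp
  then have "bdd_above ((\<lambda>u. \<bar>F u\<bar> / lip_norm \<Omega> u) ` lip0 \<Omega>)"
    by (rule bdd_aboveI2)
  then show ?thesis
    unfolding dual_norm_def using assms(2) by (rule cSUP_upper2) simp
qed

lemma lip_norm_zero: "lip_norm \<Omega> (\<lambda>x. 0) = 0"
proof (rule antisym)
  show "lip_norm \<Omega> (\<lambda>x. 0) \<le> 0"
    unfolding lip_norm_def
    by (intro cInf_lower bdd_belowI[of _ 0])
      (auto intro: lipschitz_on_constant lipschitz_on_nonneg)
qed (rule lip_norm_nonneg[OF zero_in_lip0])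

lemma dual_norm_nonneg: "F \<in> lip0_dual \<Omega> \<Longrightarrow> 0 \<le> dual_norm \<Omega> F"
  using dual_norm_bound[OF _ zero_in_lip0] by (simp add: lip_norm_zero)

lemma Metric_space_lip0_dual:
  assumes "0 \<in> \<Omega>"
  shows "Metric_space (lip0_dual \<Omega>) (dual_dist \<Omega>)"
proof
  fix F G :: "('a \<Rightarrow> real) \<Rightarrow> real"
  show "0 \<le> dual_dist \<Omega> F G"
    by (simp add: dual_dist_def dual_norm_nonneg lip0_dual_diff)
  show "dual_dist \<Omega> F G = dual_dist \<Omega> G F"
    by (simp add: dual_dist_def dual_norm_def abs_minus_commute)
next
  fix F G :: "('a \<Rightarrow> real) \<Rightarrow> real"
  assume FG: "F \<in> lip0_dual \<Omega>" "G \<in> lip0_dual \<Omega>"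
  show "dual_dist \<Omega> F G = 0 \<longleftrightarrow> F = G"
  proof
    assume 0: "dual_dist \<Omega> F G = 0"
    show "F = G"
    proof
      fix u
      show "F u = G u"
      proof (cases "u \<in> lip0 \<Omega>")
        case True
        have "\<bar>F u - G u\<bar> / lip_norm \<Omega> u \<le> 0"
          using dual_norm_bound[OF lip0_dual_diff[OF FG] True] 0 FG by (simp add: dual_dist_def)
        moreover have "F (\<lambda>x. 0) = 0" "G (\<lambda>x. 0) = 0"
          using FG by (auto simp: lip0_dual_def lip0_form_zero)
        ultimately show ?thesis
          using lip_norm_eq_0[OF True _ assms] lip_norm_nonneg[OF True]
          by (cases "lip_norm \<Omega> u = 0") (auto simp: divide_le_0_iff)
      next
        case False
        then show ?thesis using FG by (simp add: lip0_dual_def lip0_forms_def)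
      qed
    qed
  next
    assume "F = G"
    moreover have "lip0 \<Omega> \<noteq> {}" using zero_in_lip0[of \<Omega>] by blast
    then have "(SUP u\<in>lip0 \<Omega>. 0::real) = 0" by (rule cSUP_const)
    ultimately show "dual_dist \<Omega> F G = 0"
      by (simp add: dual_dist_def dual_norm_def)
  qed
next
  fix F G H :: "('a \<Rightarrow> real) \<Rightarrow> real"
  assume FGH: "F \<in> lip0_dual \<Omega>" "G \<in> lip0_dual \<Omega>" "H \<in> lip0_dual \<Omega>"
  have "dual_norm \<Omega> (\<lambda>u. F u - H u) \<le>
      dual_norm \<Omega> (\<lambda>u. F u - G u) + dual_norm \<Omega> (\<lambda>u. G u - H u)"
  proof (subst dual_norm_def, rule cSUP_least)
    show "lip0 \<Omega> \<noteq> {}" using zero_in_lip0[of \<Omega>] by blast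
  next
    fix u assume u: "u \<in> lip0 \<Omega>"
    have "\<bar>F u - H u\<bar> / lip_norm \<Omega> u \<le> (\<bar>F u - G u\<bar> + \<bar>G u - H u\<bar>) / lip_norm \<Omega> u"
      using lip_norm_nonneg[OF u] by (intro divide_right_mono) auto
    also have "\<dots> \<le> dual_norm \<Omega> (\<lambda>u. F u - G u) + dual_norm \<Omega> (\<lambda>u. G u - H u)"
      unfolding add_divide_distrib
      by (intro add_mono dual_norm_bound[OF lip0_dual_diff[OF FGH(1,2)] u]
          dual_norm_bound[OF lip0_dual_diff[OF FGH(2,3)] u])
    finally show "\<bar>F u - H u\<bar> / lip_norm \<Omega> u \<le>
      dual_norm \<Omega> (\<lambda>u. F u - G u) + dual_norm \<Omega> (\<lambda>u. G u - H u)" .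
  qed
  then show "dual_dist \<Omega> F H \<le> dual_dist \<Omega> F G + dual_dist \<Omega> G H"
    using FGH by (simp add: dual_dist_def)
qed

end

theory Submission
  imports Defs
begin

text \<open>
  A combination \<open>G\<close> of evaluations is bounded by a multiple of \<open>max\<^sub>E \<bar>u\<bar>\<close> for some finite \<open>E\<close>, so
  a norm limit of such combinations satisfies the estimate defining the dual of \<open>P\<^sub>L\<^sub>i\<^sub>p\<close>. Conversely,
  if \<open>\<bar>F u\<bar> \<le> \<theta> max\<^sub>E \<bar>u\<bar> + \<epsilon> Lip u\<close>, the points of \<open>E\<close> can be removed from the bound one at a time by
  subtracting from \<open>F\<close> a suitable multiple of the evaluation there. Each removal is the elementary
  one-dimensional step of the Hahn-Banach theorem. What remains has norm at most \<open>\<epsilon>\<close>.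
\<close>

interpretation pw: vector_space "\<lambda>(c::real) (F :: ('a \<Rightarrow> real) \<Rightarrow> real) u. c * F u"
  by (rule vector_space_pointwise)

section \<open>Linear structure and norm of \<open>lip0\<close>, and its linear forms\<close>

lemma lip0_add:
  assumes "u \<in> lip0 \<Omega>" "v \<in> lip0 \<Omega>"
  shows "(\<lambda>x. u x + v x) \<in> lip0 \<Omega>"
  using assms lipschitz_on_add[of _ \<Omega> u _ v] by (fastforce simp: lip0_def)

lemma lipschitz_on_mult_left:
  fixes u :: "'a::metric_space \<Rightarrow> real"
  assumes "L-lipschitz_on \<Omega> u"
  shows "(\<bar>c\<bar> * L)-lipschitz_on \<Omega> (\<lambda>x. c * u x)"
  using lipschitz_on_cmult_real[OF assms, of c] by simp

lemma lip0_scale: "u \<in> lip0 \<Omega> \<Longrightarrow> (\<lambda>x. c * u x) \<in> lip0 \<Omega>"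
  using lipschitz_on_mult_left[of _ \<Omega> u c] by (fastforce simp: lip0_def)

lemma lip_norm_le: "L-lipschitz_on \<Omega> u \<Longrightarrow> lip_norm \<Omega> u \<le> L"
  unfolding lip_norm_def
  by (intro cInf_lower bdd_belowI[of _ 0]) (auto dest: lipschitz_on_nonneg)

lemma lip_norm_add:
  assumes "u \<in> lip0 \<Omega>" "v \<in> lip0 \<Omega>"
  shows "lip_norm \<Omega> (\<lambda>x. u x + v x) \<le> lip_norm \<Omega> u + lip_norm \<Omega> v"
  by (intro lip_norm_le lipschitz_on_add lip_norm_lipschitz assms)

lemma lip_norm_scale:
  assumes u: "u \<in> lip0 \<Omega>"
  shows "lip_norm \<Omega> (\<lambda>x. c * u x) = \<bar>c\<bar> * lip_norm \<Omega> u"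
proof (cases "c = 0")
  case False
  have le: "lip_norm \<Omega> (\<lambda>x. a * v x) \<le> \<bar>a\<bar> * lip_norm \<Omega> v" if "v \<in> lip0 \<Omega>" for a v
    by (intro lip_norm_le lipschitz_on_mult_left lip_norm_lipschitz that)
  \<comment> \<open>For the reverse inequality, \<open>u\<close> is recovered from
    \<open>c * u\<close> by the factor \<open>1 / c\<close>.\<close>
  have "lip_norm \<Omega> u \<le> \<bar>1 / c\<bar> * lip_norm \<Omega> (\<lambda>x. c * u x)"
    using le[OF lip0_scale[OF u, of c], of "1 / c"] False by simp
  then have "\<bar>c\<bar> * lip_norm \<Omega> u \<le> lip_norm \<Omega> (\<lambda>x. c * u x)"
    using False by (simp add: field_simps)
  with le[OF u, of c] show ?thesis by simp
qed (simp add: lip_norm_zero)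

text \<open>Comparison with the base point, where \<open>u\<close> vanishes, turns the Lipschitz
  bound into a pointwise one.\<close>

lemma lip0_abs_le:
  assumes "u \<in> lip0 \<Omega>" "0 \<in> \<Omega>" "x \<in> \<Omega>"
  shows "\<bar>u x\<bar> \<le> norm x * lip_norm \<Omega> u"
  using lipschitz_onD[OF lip_norm_lipschitz[OF assms(1)] assms(3,2)] assms(1)
  by (simp add: lip0_def mult.commute)

lemma lip0_formsD:
  assumes "F \<in> lip0_forms \<Omega>" "u \<in> lip0 \<Omega>"
  shows "v \<in> lip0 \<Omega> \<Longrightarrow> F (\<lambda>x. u x + v x) = F u + F v" "F (\<lambda>x. c * u x) = c * F u"
  using assms by (auto simp: lip0_forms_def)

lemma lip0_forms_diff_scale:
  assumes "F \<in> lip0_forms \<Omega>" "G \<in> lip0_forms \<Omega>"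
  shows "(\<lambda>u. F u - c * G u) \<in> lip0_forms \<Omega>"
  using assms by (auto simp: lip0_forms_def algebra_simps)

lemma lip0_eval_form: "lip0_eval \<Omega> x \<in> lip0_forms \<Omega>"
  by (auto simp: lip0_forms_def lip0_eval_def lip0_add lip0_scale)

section \<open>Removing evaluations from a seminorm bound\<close>

text \<open>For \<open>u\<close>, \<open>w\<close> in the affine hyperplane \<open>G = 1\<close>,
  the difference lies in the kernel of \<open>G\<close>, where the seminorm \<open>p\<close>
  dominates \<open>F\<close>. Hence every \<open>F u - p u\<close> is at most every
  \<open>F w + p w\<close>. A number \<open>c\<close> separating the two families gives the bound on
  the hyperplane, and homogeneity carries it to all \<open>u\<close> with
  \<open>G u \<noteq> 0\<close>.\<close>

lemma lip0_form_dominated_mod_form: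
  assumes F: "F \<in> lip0_forms \<Omega>" and G: "G \<in> lip0_forms \<Omega>"
    and p_add: "\<And>u v. u \<in> lip0 \<Omega> \<Longrightarrow> v \<in> lip0 \<Omega> \<Longrightarrow> p (\<lambda>x. u x + v x) \<le> p u + p v"
    and p_scale: "\<And>u c. u \<in> lip0 \<Omega> \<Longrightarrow> p (\<lambda>x. c * u x) = \<bar>c\<bar> * (p u :: real)"
    and ker: "\<And>u. u \<in> lip0 \<Omega> \<Longrightarrow> G u = 0 \<Longrightarrow> \<bar>F u\<bar> \<le> p u"
  shows "\<exists>c. \<forall>u\<in>lip0 \<Omega>. \<bar>F u - c * G u\<bar> \<le> p u"
proof (cases "\<exists>w\<in>lip0 \<Omega>. G w = 1")
  case False
  \<comment> \<open>A nonzero value of \<open>G\<close> could be scaled to 1. So the kernel of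
    \<open>G\<close> is all of \<open>lip0 \<Omega>\<close>, and any \<open>c\<close> will
    do.\<close>
  have "G u = 0" if u: "u \<in> lip0 \<Omega>" for u
  proof (rule ccontr)
    assume "G u \<noteq> 0"
    then have "G (\<lambda>x. (1 / G u) * u x) = 1" unfolding lip0_formsD(2)[OF G u] by simp
    then show False using False lip0_scale[OF u] by blast
  qed
  then show ?thesis using ker by auto
next
  case True
  let ?A = "{u \<in> lip0 \<Omega>. G u = 1}"
  have sep: "F u - p u \<le> F w + p w" if "u \<in> ?A" "w \<in> ?A" for u w
  proof -
    have u: "u \<in> lip0 \<Omega>" "G u = 1" and w: "w \<in> lip0 \<Omega>" "G w = 1" using that by auto
    \<comment> \<open>The hypotheses speak of sums and multiples only, so \<open>u - w\<close> is
      formed as \<open>u + (-1) * w\<close>.\<close>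
    define w' where "w' = (\<lambda>x. (-1) * w x)"
    have w': "w' \<in> lip0 \<Omega>" unfolding w'_def by (rule lip0_scale[OF w(1)])
    have vals: "G w' = -1" "F w' = - F w" "p w' = p w"
      unfolding w'_def lip0_formsD(2)[OF G w(1)] lip0_formsD(2)[OF F w(1)] p_scale[OF w(1)]
      using w by auto
    have "G (\<lambda>x. u x + w' x) = 0"
      using lip0_formsD(1)[OF G u(1) w'] u vals by simp
    from ker[OF lip0_add[OF u(1) w'] this] have "\<bar>F u + F w'\<bar> \<le> p (\<lambda>x. u x + w' x)"
      using lip0_formsD(1)[OF F u(1) w'] by simp
    also have "\<dots> \<le> p u + p w" using p_add[OF u(1) w'] vals by simp
    finally show ?thesis using vals by simp
  qed
  \<comment> \<open>The least admissible value. The supremum is finite because, by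
    \<open>sep\<close>, any \<open>F w + p w\<close> bounds it.\<close>
  define c where "c = (SUP u\<in>?A. F u - p u)"
  have ne: "?A \<noteq> {}" using True by blast
  have bdd: "bdd_above ((\<lambda>u. F u - p u) ` ?A)"
  proof -
    obtain w where "w \<in> ?A" using ne by blast
    then show ?thesis by (intro bdd_aboveI2[of _ _ "F w + p w"] sep)
  qed
  have c: "\<bar>F u - c\<bar> \<le> p u" if u: "u \<in> ?A" for u
  proof -
    have "F u - p u \<le> c" unfolding c_def by (rule cSUP_upper[OF u bdd])
    moreover have "c \<le> F u + p u" unfolding c_def by (rule cSUP_least[OF ne sep[OF _ u]])
    ultimately show ?thesis by (simp add: abs_le_iff)
  qed
  have "\<bar>F u - c * G u\<bar> \<le> p u" if u: "u \<in> lip0 \<Omega>" for u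
  proof (cases "G u = 0")
    case False
    \<comment> \<open>Scale \<open>u\<close> into the hyperplane, use the bound there, and multiply
      back by \<open>\<bar>G u\<bar>\<close>.\<close>
    let ?v = "\<lambda>x. (1 / G u) * u x"
    have "G ?v = 1" unfolding lip0_formsD(2)[OF G u] using False by simp
    then have "?v \<in> ?A" using lip0_scale[OF u] by blast
    from c[OF this] have "\<bar>(1 / G u) * F u - c\<bar> \<le> \<bar>1 / G u\<bar> * p u"
      unfolding lip0_formsD(2)[OF F u] p_scale[OF u] .
    then have "\<bar>G u\<bar> * \<bar>(1 / G u) * F u - c\<bar> \<le> \<bar>G u\<bar> * (\<bar>1 / G u\<bar> * p u)"
      by (rule mult_left_mono) simp
    then show ?thesis using False by (simp add: abs_mult[symmetric] algebra_simps)
  qed (use ker[OF u] in simp)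
  then show ?thesis by blast
qed

text \<open>A sum over \<open>E\<close> replaces the maximum because one summand splits off cleanly:
  the rest is again a seminorm and can serve as the \<open>p\<close> of the one-dimensional step.
  The form varies in the induction, since each step passes from \<open>F\<close> to
  \<open>F - c * lip0_eval \<Omega> x\<close>.\<close>

lemma lip0_form_near_span_eval:
  assumes "finite E" "F \<in> lip0_forms \<Omega>" "\<theta> \<ge> 0"
    and "\<And>u v. u \<in> lip0 \<Omega> \<Longrightarrow> v \<in> lip0 \<Omega> \<Longrightarrow> p (\<lambda>x. u x + v x) \<le> p u + p v"
    and "\<And>u c. u \<in> lip0 \<Omega> \<Longrightarrow> p (\<lambda>x. c * u x) = \<bar>c\<bar> * (p u :: real)"
    and "\<And>u. u \<in> lip0 \<Omega> \<Longrightarrow> \<bar>F u\<bar> \<le> \<theta> * (\<Sum>x\<in>E. \<bar>u x\<bar>) + p u"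
  shows "\<exists>G\<in>pw.span (lip0_eval \<Omega> ` E). \<forall>u\<in>lip0 \<Omega>. \<bar>F u - G u\<bar> \<le> p u"
  using assms(1,2,6)
proof (induction E arbitrary: F)
  case empty
  then show ?case by (intro bexI[of _ 0] pw.span_zero) auto
next
  case (insert x E)
  let ?q = "\<lambda>u. \<theta> * (\<Sum>y\<in>E. \<bar>u y\<bar>) + p u"
  have "\<exists>c. \<forall>u\<in>lip0 \<Omega>. \<bar>F u - c * lip0_eval \<Omega> x u\<bar> \<le> ?q u"
  proof (rule lip0_form_dominated_mod_form[OF insert.prems(1) lip0_eval_form])
    fix u v assume uv: "u \<in> lip0 \<Omega>" "v \<in> lip0 \<Omega>"
    have "(\<Sum>y\<in>E. \<bar>u y + v y\<bar>) \<le> (\<Sum>y\<in>E. \<bar>u y\<bar>) + (\<Sum>y\<in>E. \<bar>v y\<bar>)"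
      by (simp add: sum.distrib[symmetric] sum_mono)
    from mult_left_mono[OF this \<open>\<theta> \<ge> 0\<close>] assms(4)[OF uv]
    show "?q (\<lambda>x. u x + v x) \<le> ?q u + ?q v" by (simp add: algebra_simps)
  next
    fix u c assume "u \<in> lip0 \<Omega>"
    then show "?q (\<lambda>x. c * u x) = \<bar>c\<bar> * ?q u"
      by (simp add: assms(5) abs_mult sum_distrib_left[symmetric] algebra_simps)
  next
    \<comment> \<open>On the kernel of the evaluation at \<open>x\<close> the summand
      \<open>\<bar>u x\<bar>\<close> vanishes.\<close>
    fix u assume "u \<in> lip0 \<Omega>" "lip0_eval \<Omega> x u = 0"
    then show "\<bar>F u\<bar> \<le> ?q u"
      using insert.prems(2)[of u] insert.hyps by (simp add: lip0_eval_def)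
  qed
  then obtain c where c: "\<And>u. u \<in> lip0 \<Omega> \<Longrightarrow> \<bar>F u - c * lip0_eval \<Omega> x u\<bar> \<le> ?q u" by blast
  from insert.IH[OF lip0_forms_diff_scale[OF insert.prems(1) lip0_eval_form] this]
  obtain G where G: "G \<in> pw.span (lip0_eval \<Omega> ` E)"
    and le: "\<forall>u\<in>lip0 \<Omega>. \<bar>F u - c * lip0_eval \<Omega> x u - G u\<bar> \<le> p u" by blast
  have "G \<in> pw.span (lip0_eval \<Omega> ` insert x E)"
    using G pw.span_mono[of "lip0_eval \<Omega> ` E" "lip0_eval \<Omega> ` insert x E"] by blast
  \<comment> \<open>The multiple subtracted in this step is added back to the approximant
    \<open>G\<close> of the remainder.\<close>
  then have "(\<lambda>u. c * lip0_eval \<Omega> x u) + G \<in> pw.span (lip0_eval \<Omega> ` insert x E)"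
    by (rule pw.span_add[OF pw.span_scale[OF pw.span_base[OF imageI[OF insertI1]]]])
  then show ?case using le by (intro bexI) (auto simp: diff_diff_eq)
qed

section \<open>Finite combinations of evaluations as bounded forms\<close>

text \<open>Quantifying over a bound \<open>M\<close> instead of writing \<open>Max\<close> keeps
  the estimate meaningful for \<open>E = {}\<close>, where the induction starts, and lets
  \<open>E\<close> grow without recomputing a maximum. Adding
  \<open>c * lip0_eval \<Omega> x\<close> costs the point \<open>x\<close> and the summand
  \<open>\<bar>c\<bar>\<close> in \<theta>.\<close>

lemma span_eval_bounded:
  assumes "G \<in> pw.span (lip0_eval \<Omega> ` \<Omega>)"
  shows "G \<in> lip0_forms \<Omega> \<and> (\<exists>E \<theta>. finite E \<and> E \<subseteq> \<Omega> \<and> \<theta> \<ge> 0 \<and>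
    (\<forall>u\<in>lip0 \<Omega>. \<forall>M\<ge>0. (\<forall>x\<in>E. \<bar>u x\<bar> \<le> M) \<longrightarrow> \<bar>G u\<bar> \<le> \<theta> * M))"
  using assms
proof (induction rule: pw.span_induct_alt)
  case base
  show ?case
    by (rule conjI, simp add: lip0_forms_def, rule exI[of _ "{}"], rule exI[of _ 0]) simp
next
  case (step c e G)
  then obtain x E \<theta> where x: "e = lip0_eval \<Omega> x" "x \<in> \<Omega>"
    and E: "finite E" "E \<subseteq> \<Omega>" "\<theta> \<ge> 0"
    and le: "\<And>u M. u \<in> lip0 \<Omega> \<Longrightarrow> M \<ge> 0 \<Longrightarrow> \<forall>x\<in>E. \<bar>u x\<bar> \<le> M \<Longrightarrow> \<bar>G u\<bar> \<le> \<theta> * M"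
    by blast
  \<comment> \<open>Closure of the forms is available for differences, so the added multiple enters
    with coefficient \<open>- c\<close>.\<close>
  have "(\<lambda>u. G u - (- c) * e u) \<in> lip0_forms \<Omega>"
    using step.IH lip0_forms_diff_scale[of G \<Omega> e] lip0_eval_form x(1) by blast
  then have "(\<lambda>u. c * e u) + G \<in> lip0_forms \<Omega>" by (simp add: plus_fun_def add.commute)
  moreover have "\<bar>((\<lambda>u. c * e u) + G) u\<bar> \<le> (\<bar>c\<bar> + \<theta>) * M"
    if u: "u \<in> lip0 \<Omega>" and M: "M \<ge> 0" "\<forall>x\<in>insert x E. \<bar>u x\<bar> \<le> M" for u M
  proof -
    have "\<bar>c * u x\<bar> \<le> \<bar>c\<bar> * M" using M by (simp add: abs_mult mult_left_mono)
    then show ?thesis using le[OF u M(1)] M(2) u x(1)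
      by (simp add: lip0_eval_def algebra_simps)
  qed
  moreover have "finite (insert x E)" "insert x E \<subseteq> \<Omega>" "\<bar>c\<bar> + \<theta> \<ge> 0"
    using E x(2) by auto
  ultimately show ?case by blast
qed

text \<open>This places the span inside the carrier of the metric space in which its closure is
  taken. By \<open>lip0_abs_le\<close>, the sum of the norms over \<open>E\<close> times the
  Lipschitz norm is an admissible \<open>M\<close>, also for empty \<open>E\<close>.\<close>

lemma span_eval_subset_dual:
  assumes "0 \<in> \<Omega>"
  shows "pw.span (lip0_eval \<Omega> ` \<Omega>) \<subseteq> lip0_dual \<Omega>"
proof
  fix G assume "G \<in> pw.span (lip0_eval \<Omega> ` \<Omega>)"
  from span_eval_bounded[OF this] obtain E \<theta> where G: "G \<in> lip0_forms \<Omega>"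
    and E: "finite E" "E \<subseteq> \<Omega>" "\<theta> \<ge> 0"
    and le: "\<And>u M. u \<in> lip0 \<Omega> \<Longrightarrow> M \<ge> 0 \<Longrightarrow> \<forall>x\<in>E. \<bar>u x\<bar> \<le> M \<Longrightarrow> \<bar>G u\<bar> \<le> \<theta> * M"
    by blast
  have "\<bar>G u\<bar> \<le> (\<theta> * (\<Sum>x\<in>E. norm x)) * lip_norm \<Omega> u" if u: "u \<in> lip0 \<Omega>" for u
  proof -
    have "\<bar>u x\<bar> \<le> (\<Sum>x\<in>E. norm x) * lip_norm \<Omega> u" if "x \<in> E" for x
    proof -
      have "\<bar>u x\<bar> \<le> norm x * lip_norm \<Omega> u" using lip0_abs_le[OF u assms] that E(2) by blast
      also have "\<dots> \<le> (\<Sum>x\<in>E. norm x) * lip_norm \<Omega> u"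
        using that E(1) lip_norm_nonneg[OF u] by (intro mult_right_mono member_le_sum) auto
      finally show ?thesis .
    qed
    then show ?thesis using le[OF u, of "(\<Sum>x\<in>E. norm x) * lip_norm \<Omega> u"] lip_norm_nonneg[OF u]
      by (simp add: sum_nonneg mult.assoc)
  qed
  with G show "G \<in> lip0_dual \<Omega>" by (auto simp: lip0_dual_def)
qed

section \<open>Operator norm and strong norm\<close>

text \<open>The quotient in \<open>dual_norm\<close> says nothing when
  \<open>lip_norm \<Omega> u = 0\<close>. That case is separate: such a \<open>u\<close> is zero, as
  \<open>0 \<in> \<Omega>\<close>.\<close>

lemma dual_norm_abs_le:
  assumes "F \<in> lip0_dual \<Omega>" "u \<in> lip0 \<Omega>" "0 \<in> \<Omega>"
  shows "\<bar>F u\<bar> \<le> dual_norm \<Omega> F * lip_norm \<Omega> u"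
proof (cases "lip_norm \<Omega> u = 0")
  case True
  then have "F u = 0"
    using lip_norm_eq_0[OF assms(2) True assms(3)] assms(1) lip0_form_zero[of F \<Omega>]
    by (simp add: lip0_dual_def)
  then show ?thesis using True by simp
next
  case False
  then have "lip_norm \<Omega> u > 0" using lip_norm_nonneg[OF assms(2)] by simp
  then show ?thesis using dual_norm_bound[OF assms(1,2)] by (simp add: divide_le_eq)
qed

lemma dual_norm_least:
  assumes "K \<ge> 0" "\<And>u. u \<in> lip0 \<Omega> \<Longrightarrow> \<bar>F u\<bar> \<le> K * lip_norm \<Omega> u"
  shows "dual_norm \<Omega> F \<le> K"
  unfolding dual_norm_def
proof (rule cSUP_least)
  show "lip0 \<Omega> \<noteq> {}" using zero_in_lip0[of \<Omega>] by blast
next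
  fix u assume u: "u \<in> lip0 \<Omega>"
  show "\<bar>F u\<bar> / lip_norm \<Omega> u \<le> K"
    using assms(1) assms(2)[OF u] lip_norm_nonneg[OF u]
    by (cases "lip_norm \<Omega> u = 0") (auto simp: divide_le_eq)
qed

text \<open>One supremum runs over quotients, the other over the unit ball; scaling a
  \<open>u\<close> of positive norm to norm 1 compares them.\<close>

lemma dual_norm_eq_strong_norm:
  assumes F: "F \<in> lip0_dual \<Omega>" and "0 \<in> \<Omega>"
  shows "dual_norm \<Omega> F = strong_norm \<Omega> F"
proof (rule antisym)
  let ?S = "{\<bar>F u\<bar> |u. u \<in> lip0 \<Omega> \<and> lip_norm \<Omega> u \<le> 1}"
  have ub: "y \<le> dual_norm \<Omega> F" if y: "y \<in> ?S" for y
  proof -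
    obtain u where u: "y = \<bar>F u\<bar>" "u \<in> lip0 \<Omega>" "lip_norm \<Omega> u \<le> 1" using y by blast
    have "\<bar>F u\<bar> \<le> dual_norm \<Omega> F * lip_norm \<Omega> u" by (rule dual_norm_abs_le[OF F u(2) assms(2)])
    also have "\<dots> \<le> dual_norm \<Omega> F" using dual_norm_nonneg[OF F] u(3) by (simp add: mult_left_le)
    finally show ?thesis using u(1) by simp
  qed
  have upper: "\<bar>F u\<bar> \<le> strong_norm \<Omega> F" if "u \<in> lip0 \<Omega>" "lip_norm \<Omega> u \<le> 1" for u
    unfolding strong_norm_def using that ub by (intro cSup_upper bdd_aboveI) blast+
  \<comment> \<open>The zero function shows that the set under the supremum is nonempty and that the
    supremum is nonnegative, as \<open>dual_norm_least\<close> requires.\<close>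
  have zero: "(\<lambda>x. 0) \<in> lip0 \<Omega>" "lip_norm \<Omega> (\<lambda>x. 0) \<le> 1"
    by (simp_all add: zero_in_lip0 lip_norm_zero)
  then show "strong_norm \<Omega> F \<le> dual_norm \<Omega> F"
    unfolding strong_norm_def using ub by (intro cSup_least) blast+
  show "dual_norm \<Omega> F \<le> strong_norm \<Omega> F"
  proof (rule dual_norm_least)
    show "0 \<le> strong_norm \<Omega> F" using upper[OF zero] by simp
  next
    fix u assume u: "u \<in> lip0 \<Omega>"
    show "\<bar>F u\<bar> \<le> strong_norm \<Omega> F * lip_norm \<Omega> u"
    proof (cases "lip_norm \<Omega> u = 0")
      case True
      then show ?thesis using dual_norm_abs_le[OF F u assms(2)] by simp
    next
      case False
      then have pos: "lip_norm \<Omega> u > 0" using lip_norm_nonneg[OF u] by simp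
      have "\<bar>(1 / lip_norm \<Omega> u) * F u\<bar> \<le> strong_norm \<Omega> F"
        using upper[OF lip0_scale[OF u, of "1 / lip_norm \<Omega> u"]] pos
          lip_norm_scale[OF u, of "1 / lip_norm \<Omega> u"]
          lip0_formsD(2)[of F \<Omega> u "1 / lip_norm \<Omega> u"] F u
        by (simp add: lip0_dual_def)
      then show ?thesis using pos by (simp add: abs_mult divide_le_eq)
    qed
  qed
qed

section \<open>Identification of the free space with the dual of P_Lip\<close>

text \<open>The single choice \<epsilon> = 1 suffices, since on a finite \<open>E\<close> the
  maximum of \<open>\<bar>u x\<bar>\<close> is itself controlled by the Lipschitz norm.\<close>

lemma plip_dual_subset_dual:
  assumes "0 \<in> \<Omega>"
  shows "plip_dual \<Omega> \<subseteq> lip0_dual \<Omega>"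
proof
  fix F assume F: "F \<in> plip_dual \<Omega>"
  then obtain E \<theta> where E: "finite E" "E \<noteq> {}" "E \<subseteq> \<Omega>" "\<theta> > (0::real)"
    and le: "\<forall>u\<in>lip0 \<Omega>. \<bar>F u\<bar> \<le> \<theta> * Max ((\<lambda>x. \<bar>u x\<bar>) ` E) + 1 * lip_norm \<Omega> u"
    unfolding plip_dual_def using zero_less_one by blast
  have "\<bar>F u\<bar> \<le> (\<theta> * Max (norm ` E) + 1) * lip_norm \<Omega> u" if u: "u \<in> lip0 \<Omega>" for u
  proof -
    have "Max ((\<lambda>x. \<bar>u x\<bar>) ` E) \<le> Max (norm ` E) * lip_norm \<Omega> u"
    proof (subst Max_le_iff; (use E in simp)?)
      show "\<forall>x\<in>E. \<bar>u x\<bar> \<le> Max (norm ` E) * lip_norm \<Omega> u"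
      proof
        fix x assume x: "x \<in> E"
        have "\<bar>u x\<bar> \<le> norm x * lip_norm \<Omega> u" using lip0_abs_le[OF u assms] x E(3) by blast
        also have "\<dots> \<le> Max (norm ` E) * lip_norm \<Omega> u"
          using x E(1) lip_norm_nonneg[OF u] by (intro mult_right_mono) auto
        finally show "\<bar>u x\<bar> \<le> Max (norm ` E) * lip_norm \<Omega> u" .
      qed
    qed
    then have "\<theta> * Max ((\<lambda>x. \<bar>u x\<bar>) ` E) \<le> \<theta> * (Max (norm ` E) * lip_norm \<Omega> u)"
      using E(4) by simp
    then show ?thesis using le u by (fastforce simp: algebra_simps)
  qed
  with F show "F \<in> lip0_dual \<Omega>" by (auto simp: lip0_dual_def plip_dual_def)
qed

text \<open>In a metric space, \<open>F\<close> is in the closure when every ball around it meets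
  the set. All forms involved lie in the carrier, so \<open>dual_dist\<close> reduces to the norm of
  the difference.\<close>

lemma in_lip_free_iff:
  assumes "0 \<in> \<Omega>"
  shows "F \<in> lip_free \<Omega> \<longleftrightarrow> F \<in> lip0_dual \<Omega> \<and>
    (\<forall>r>0. \<exists>G\<in>pw.span (lip0_eval \<Omega> ` \<Omega>). dual_norm \<Omega> (\<lambda>u. F u - G u) < r)"
proof -
  interpret Metric_space "lip0_dual \<Omega>" "dual_dist \<Omega>" by (rule Metric_space_lip0_dual[OF assms])
  show ?thesis
    unfolding lip_free_def dual_topology_def metric_closure_of
    using span_eval_subset_dual[OF assms] by (fastforce simp: dual_dist_def)
qed

lemma lip_free_eq_plip_dual:
  assumes "0 \<in> \<Omega>"
  shows "lip_free \<Omega> = plip_dual \<Omega>"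
proof (intro set_eqI iffI)
  fix F assume "F \<in> lip_free \<Omega>"
  then have F: "F \<in> lip0_dual \<Omega>" and
    approx: "\<And>r. r > 0 \<Longrightarrow> \<exists>G\<in>pw.span (lip0_eval \<Omega> ` \<Omega>). dual_norm \<Omega> (\<lambda>u. F u - G u) < r"
    by (auto simp: in_lip_free_iff[OF assms])
  have "\<exists>E \<theta>. finite E \<and> E \<noteq> {} \<and> E \<subseteq> \<Omega> \<and> \<theta> > 0 \<and>
     (\<forall>u\<in>lip0 \<Omega>. \<bar>F u\<bar> \<le> \<theta> * Max ((\<lambda>x. \<bar>u x\<bar>) ` E) + \<epsilon> * lip_norm \<Omega> u)"
    if \<epsilon>: "\<epsilon> > 0" for \<epsilon> :: real
  proof -
    obtain G where G: "G \<in> pw.span (lip0_eval \<Omega> ` \<Omega>)"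
      and small: "dual_norm \<Omega> (\<lambda>u. F u - G u) < \<epsilon>" using approx[OF \<epsilon>] by blast
    obtain E \<theta> where E: "finite E" "E \<subseteq> \<Omega>" "\<theta> \<ge> 0"
      and le: "\<And>u M. u \<in> lip0 \<Omega> \<Longrightarrow> M \<ge> 0 \<Longrightarrow> \<forall>x\<in>E. \<bar>u x\<bar> \<le> M \<Longrightarrow> \<bar>G u\<bar> \<le> \<theta> * M"
      using span_eval_bounded[OF G] by blast
    have "G \<in> lip0_dual \<Omega>" using G span_eval_subset_dual[OF assms] by blast
    note FG = lip0_dual_diff[OF F this]
    \<comment> \<open>\<open>span_eval_bounded\<close> allows \<open>E = {}\<close> and
      \<open>\<theta> = 0\<close>, whereas \<open>plip_dual\<close> asks for a nonempty set and a
      positive factor; hence \<open>insert 0 E\<close> and \<open>\<theta> + 1\<close>.\<close>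
    have "\<bar>F u\<bar> \<le> (\<theta> + 1) * Max ((\<lambda>x. \<bar>u x\<bar>) ` insert 0 E) + \<epsilon> * lip_norm \<Omega> u"
      if u: "u \<in> lip0 \<Omega>" for u
    proof -
      let ?M = "Max ((\<lambda>x. \<bar>u x\<bar>) ` insert 0 E)"
      have M: "\<bar>u x\<bar> \<le> ?M" if "x \<in> insert 0 E" for x
        using that E(1) by (intro Max_ge) auto
      have M0: "0 \<le> ?M" using M[OF insertI1] by (rule order_trans[OF abs_ge_zero])
      have "\<bar>G u\<bar> \<le> \<theta> * ?M" using M by (intro le[OF u M0]) auto
      also have "\<dots> \<le> (\<theta> + 1) * ?M" using M0 by (intro mult_right_mono) auto
      finally have "\<bar>G u\<bar> \<le> (\<theta> + 1) * ?M" .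
      moreover have "\<bar>F u - G u\<bar> \<le> \<epsilon> * lip_norm \<Omega> u"
        using dual_norm_abs_le[OF FG u assms] small lip_norm_nonneg[OF u]
          mult_right_mono[of "dual_norm \<Omega> (\<lambda>u. F u - G u)" \<epsilon> "lip_norm \<Omega> u"] by linarith
      ultimately show ?thesis by linarith
    qed
    then show ?thesis using E assms
      by (intro exI[of _ "insert 0 E"] exI[of _ "\<theta> + 1"]) auto
  qed
  then show "F \<in> plip_dual \<Omega>" using F by (simp add: plip_dual_def lip0_dual_def)
next
  fix F assume F: "F \<in> plip_dual \<Omega>"
  have "\<exists>G\<in>pw.span (lip0_eval \<Omega> ` \<Omega>). dual_norm \<Omega> (\<lambda>u. F u - G u) < r" if r: "r > 0" for r
  proof -
    \<comment> \<open>Half of \<open>r\<close> leaves room for the strict inequality, since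
      \<open>dual_norm_least\<close> yields only \<le>.\<close>
    have "r / 2 > 0" using r by simp
    moreover have "\<forall>\<epsilon>>0. \<exists>E \<theta>. finite E \<and> E \<noteq> {} \<and> E \<subseteq> \<Omega> \<and> \<theta> > 0 \<and>
        (\<forall>u\<in>lip0 \<Omega>. \<bar>F u\<bar> \<le> \<theta> * Max ((\<lambda>x. \<bar>u x\<bar>) ` E) + \<epsilon> * lip_norm \<Omega> u)"
      using F by (simp add: plip_dual_def)
    ultimately obtain E \<theta> where E: "finite E" "E \<noteq> {}" "E \<subseteq> \<Omega>" "\<theta> > (0::real)"
      and le: "\<And>u. u \<in> lip0 \<Omega> \<Longrightarrow> \<bar>F u\<bar> \<le> \<theta> * Max ((\<lambda>x. \<bar>u x\<bar>) ` E) + r / 2 * lip_norm \<Omega> u"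
      by meson
    \<comment> \<open>The seminorm \<open>p\<close> is here \<open>r / 2\<close> times the Lipschitz
      norm, the only term left once every point of \<open>E\<close> is removed.\<close>
    have "\<exists>G\<in>pw.span (lip0_eval \<Omega> ` E). \<forall>u\<in>lip0 \<Omega>. \<bar>F u - G u\<bar> \<le> r / 2 * lip_norm \<Omega> u"
    proof (rule lip0_form_near_span_eval[OF E(1)])
      show "F \<in> lip0_forms \<Omega>" using F by (simp add: plip_dual_def)
      show "\<theta> \<ge> 0" using E(4) by simp
    next
      fix u v assume "u \<in> lip0 \<Omega>" "v \<in> lip0 \<Omega>"
      from mult_left_mono[OF lip_norm_add[OF this], of "r / 2"] r
      show "r / 2 * lip_norm \<Omega> (\<lambda>x. u x + v x) \<le> r / 2 * lip_norm \<Omega> u + r / 2 * lip_norm \<Omega> v"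
        by (simp add: algebra_simps)
    next
      fix u c assume "u \<in> lip0 \<Omega>"
      then show "r / 2 * lip_norm \<Omega> (\<lambda>x. c * u x) = \<bar>c\<bar> * (r / 2 * lip_norm \<Omega> u)"
        by (simp add: lip_norm_scale)
    next
      fix u assume u: "u \<in> lip0 \<Omega>"
      \<comment> \<open>A maximum of nonnegative terms is at most their sum, the shape that the
        removal of points works with.\<close>
      have "Max ((\<lambda>x. \<bar>u x\<bar>) ` E) \<le> (\<Sum>x\<in>E. \<bar>u x\<bar>)"
        using E by (subst Max_le_iff) (auto intro!: member_le_sum)
      then have "\<theta> * Max ((\<lambda>x. \<bar>u x\<bar>) ` E) \<le> \<theta> * (\<Sum>x\<in>E. \<bar>u x\<bar>)" using E(4) by simp
      then show "\<bar>F u\<bar> \<le> \<theta> * (\<Sum>x\<in>E. \<bar>u x\<bar>) + r / 2 * lip_norm \<Omega> u" using le[OF u] by linarith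
    qed
    then obtain G where G: "G \<in> pw.span (lip0_eval \<Omega> ` E)"
      and close: "\<And>u. u \<in> lip0 \<Omega> \<Longrightarrow> \<bar>F u - G u\<bar> \<le> r / 2 * lip_norm \<Omega> u" by blast
    have "dual_norm \<Omega> (\<lambda>u. F u - G u) \<le> r / 2" using r close by (intro dual_norm_least) auto
    moreover have "G \<in> pw.span (lip0_eval \<Omega> ` \<Omega>)"
      using G pw.span_mono[OF image_mono[OF E(3)]] by blast
    ultimately show ?thesis using r by (intro bexI[of _ G]) auto
  qed
  then show "F \<in> lip_free \<Omega>"
    using F plip_dual_subset_dual[OF assms] by (auto simp: in_lip_free_iff[OF assms])
qed

theorem theorem4p1p3:
  fixes \<Omega> :: "(real ^ 'm) set"
  assumes "CARD('m) \<ge> 2"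
    and "open \<Omega>"
    and "0 \<in> \<Omega>"
  shows "lip_free \<Omega> = plip_dual \<Omega> \<and>
    (\<forall>F\<in>lip_free \<Omega>. dual_norm \<Omega> F = strong_norm \<Omega> F)"
proof (intro conjI ballI)
  show "lip_free \<Omega> = plip_dual \<Omega>" by (rule lip_free_eq_plip_dual[OF assms(3)])
next
  fix F assume "F \<in> lip_free \<Omega>"
  then have "F \<in> lip0_dual \<Omega>" by (simp add: in_lip_free_iff[OF assms(3)])
  then show "dual_norm \<Omega> F = strong_norm \<Omega> F" by (rule dual_norm_eq_strong_norm[OF _ assms(3)])
qed

end
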